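(* Let $a,b>0$ and $\nu\geq 0$. Then for each $N\in\mathbb{N}$ (with $N\ge 1$), $$(1+\nu)a-\nu b+\nu\sum_{j=1}^{N}2^{j-1}\left(\sqrt{a}-\sqrt[2^j]{a^{2^{j-1}-1}b}\right)^2\leq a^{1+\nu}b^{-\nu}.$$ *)

theory Defs
  imports Complex_Main
begin

end

theory Submission
  imports Defs
begin

text \<open>
  Put \<open>L = ln (b / a)\<close> and \<open>r j = exp (L / 2 ^ j)\<close>, so that \<open>(r (j + 1))\<^sup>2 = r j\<close>. The \<open>j\<close>-th root is
  \<open>sqrt a * r j\<close>, so the \<open>j\<close>-th summand equals \<open>a * ((2 ^ j - 2 ^ j * r j) - (2 ^ (j - 1) - 2 ^ (j - 1) * r (j - 1)))\<close>
  and the sum telescopes. The left-hand side becomes \<open>a + \<nu> * a * 2 ^ N * (1 - r N)\<close>, and two applications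
  of \<open>1 + x \<le> exp x\<close> bound it first by \<open>a * (1 - \<nu> * L)\<close> and then by \<open>a * exp (- \<nu> * L)\<close>.
\<close>

text \<open>The \<open>2 ^ Suc j\<close>-th power of the right-hand side is
  \<open>a ^ (2 ^ j) * (b / a)\<close>, and positive roots are unique.\<close>

lemma root_eq_sqrt_mult_exp:
  fixes a b :: real
  assumes "a > 0" "b > 0"
  shows "root (2 ^ Suc j) (a ^ (2 ^ j - 1) * b) = sqrt a * exp (ln (b / a) / 2 ^ Suc j)"
proof (rule real_root_pos_unique)
  have "(sqrt a) ^ (2 ^ Suc j) = a ^ (2 ^ j)"
    using assms by (simp add: power_mult)
  moreover have "exp (ln (b / a) / 2 ^ Suc j) ^ (2 ^ Suc j) = b / a"
    using assms by (simp flip: exp_of_nat_mult)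
  moreover have "a ^ (2 ^ j) = a ^ (2 ^ j - 1) * a"
    by (metis power_minus_mult zero_less_numeral zero_less_power)
  ultimately show "(sqrt a * exp (ln (b / a) / 2 ^ Suc j)) ^ (2 ^ Suc j) = a ^ (2 ^ j - 1) * b"
    using assms by (simp only: power_mult_distrib) simp
qed (use assms in auto)

lemma sum_dyadic_roots:
  fixes a b :: real
  assumes "a > 0" "b > 0"
  shows "(\<Sum>j = 1..N. 2 ^ (j - 1) * (sqrt a - root (2 ^ j) (a ^ (2 ^ (j - 1) - 1) * b))\<^sup>2)
    = a * 2 ^ N * (1 - exp (ln (b / a) / 2 ^ N)) - a + b"
proof (induction N)
  case 0
  show ?case using assms by (simp add: algebra_simps)
next
  case (Suc N)
  define r where "r = exp (ln (b / a) / 2 ^ Suc N)"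
  have r2: "exp (ln (b / a) / 2 ^ N) = r\<^sup>2"
    by (simp add: r_def flip: exp_double)
  have "root (2 ^ Suc N) (a ^ (2 ^ N - 1) * b) = sqrt a * r"
    unfolding r_def using assms by (rule root_eq_sqrt_mult_exp)
  then have "(sqrt a - root (2 ^ Suc N) (a ^ (2 ^ N - 1) * b))\<^sup>2 = (sqrt a * (1 - r))\<^sup>2"
    by (simp add: algebra_simps)
  also have "\<dots> = a * (1 - r)\<^sup>2"
    using assms by (simp add: power_mult_distrib)
  finally have "(\<Sum>j = 1..Suc N. 2 ^ (j - 1) * (sqrt a - root (2 ^ j) (a ^ (2 ^ (j - 1) - 1) * b))\<^sup>2)
      = (a * 2 ^ N * (1 - r\<^sup>2) - a + b) + 2 ^ N * (a * (1 - r)\<^sup>2)"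
    using Suc.IH r2 by simp
  \<comment> \<open>Up to the factor \<open>a * 2 ^ N\<close> this is
    \<open>(1 - r\<^sup>2) + (1 - r)\<^sup>2 = 2 * (1 - r)\<close>.\<close>
  also have "\<dots> = a * 2 ^ Suc N * (1 - r) - a + b"
    by (simp add: power2_eq_square algebra_simps)
  finally show ?case by (simp only: r_def)
qed

theorem theorem2p2:
  fixes a b \<nu> :: real and N :: nat
  assumes "a > 0" and "b > 0" and "\<nu> \<ge> 0" and "N \<ge> 1"
  shows "(1 + \<nu>) * a - \<nu> * b
      + \<nu> * (\<Sum>j = 1..N. 2 ^ (j - 1) * (sqrt a - root (2 ^ j) (a ^ (2 ^ (j - 1) - 1) * b))\<^sup>2)
    \<le> a powr (1 + \<nu>) * b powr (- \<nu>)"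
proof -
  define L where "L = ln (b / a)"
  have "1 - exp (L / 2 ^ N) \<le> - (L / 2 ^ N)"
    using exp_ge_add_one_self[of "L / 2 ^ N"] by linarith
  then have "2 ^ N * (1 - exp (L / 2 ^ N)) \<le> 2 ^ N * (- (L / 2 ^ N))"
    by (rule mult_left_mono) simp
  then have bound: "2 ^ N * (1 - exp (L / 2 ^ N)) \<le> - L"
    by simp
  \<comment> \<open>The boundary term \<open>- a + b\<close> of the telescoped sum, times
    \<open>\<nu>\<close>, cancels all of \<open>(1 + \<nu>) * a - \<nu> * b\<close> except
    \<open>a\<close>.\<close>
  have "(1 + \<nu>) * a - \<nu> * b
      + \<nu> * (\<Sum>j = 1..N. 2 ^ (j - 1) * (sqrt a - root (2 ^ j) (a ^ (2 ^ (j - 1) - 1) * b))\<^sup>2)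
    = a * (1 + \<nu> * (2 ^ N * (1 - exp (L / 2 ^ N))))"
    unfolding sum_dyadic_roots[OF assms(1,2)] L_def by (simp add: algebra_simps)
  also have "\<dots> \<le> a * (1 + \<nu> * (- L))"
    using assms bound by (intro mult_left_mono add_left_mono) auto
  also have "\<dots> \<le> a * exp (\<nu> * (- L))"
    using assms by (intro mult_left_mono exp_ge_add_one_self) auto
  also have "\<dots> = exp (ln a + \<nu> * (- L))"
    using assms by (simp only: exp_add exp_ln)
  also have "\<dots> = a powr (1 + \<nu>) * b powr (- \<nu>)"
    using assms by (simp add: powr_def L_def ln_div algebra_simps flip: exp_add)
  finally show ?thesis .
qed

end
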